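(* Let $X$ be a complex Banach space, $n\ge 1$, and $T=(T_1,\dots,T_n)\in\mathcal{C}_n(X)$. Then $T$ has finite ascent (i.e. $a(T)<\infty$) if and only if $\overline{N^{\infty}(T)}\cap R^{\infty}(T)=\{0\}$.
   Context: $\mathcal{B}(X)$ is the algebra of bounded linear operators on $X$; $N(\cdot)$ and $R(\cdot)$ denote null space and range of an operator; $\mathbb{N}=\{0,1,2,\dots\}$. $\mathcal{B}_n(X)$ is the set of $n$-tuples $T=(T_1,\dots,T_n)$ of operators in $\mathcal{B}(X)$ with $T_iT_j=T_jT_i$ for all $i,j$. Two $n$-tuples $T,S$ are mutually commuting (with each other) if $T_iS_j=S_jT_i$ for all $i,j$. For $k\in\mathbb{N}$: $T^k=(T_1^k,\dots,T_n^k)$, $N(T^k)=\bigcap_{i=1}^n N(T_i^k)$, $R(T^k)=\sum_{i=1}^n R(T_i^k)$. $R^\infty(T)=\bigcap_{k\ge 0}R(T^k)$, $N^\infty(T)=\bigcup_{k\ge 0}N(T^k)$. The ascent is $a(T)=\min\{k\in\mathbb{N}: N(T^k)=N(T^{k+1})\}$, and $a(T)=\infty$ if no such $k$ exists. For an $n$-tuple $A$, $\delta_A:X\to X^n$ is $\delta_A(x)=(A_1x,\dots,A_nx)$. $\Phi_+^n(X)$ is the set of $T\in\mathcal{B}_n(X)$ with $\dim N(T)<\infty$ and $R(\delta_T)$ closed. $\mathcal{C}_n(X)$ is the set of $T\in\mathcal{B}_n(X)$ such that: (i) $T\in\Phi_+^n(X)$; (ii) there is $k_0\in\mathbb{N}$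 such that for all $k\ge k_0$ and all $i\neq j$ in $\{1,\dots,n\}$, $T_i^k(N(T_i^{k+1}))\subset N(T_j)$; (iii) there is $m\in\mathbb{N}$ such that for all $p\ge m$ there is $A=(A_1,\dots,A_n)\in\mathcal{B}_n(X)$ mutually commuting with $T$ with $N(A)=\bigcap_i N(A_i)=\{0\}$ and $\delta_A(N(T^p)\cap R(T^p))\subset R(\delta_{T^p})$. *)

theory Defs
  imports "HOL-Analysis.Analysis"
begin

class complex_banach = banach +
  fixes scaleC :: "complex \<Rightarrow> 'a \<Rightarrow> 'a" (infixr "*\<^sub>C" 75)
  assumes scaleC_add_right: "c *\<^sub>C (x + y) = c *\<^sub>C x + c *\<^sub>C y"
    and scaleC_add_left: "(c + d) *\<^sub>C x = c *\<^sub>C x + d *\<^sub>C x"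
    and scaleC_scaleC: "c *\<^sub>C (d *\<^sub>C x) = (c * d) *\<^sub>C x"
    and scaleC_one: "1 *\<^sub>C x = x"
    and scaleR_scaleC: "r *\<^sub>R x = complex_of_real r *\<^sub>C x"
    and norm_scaleC: "norm (c *\<^sub>C x) = cmod c * norm x"

global_interpretation complex_vector:
  vector_space "scaleC :: complex \<Rightarrow> 'a \<Rightarrow> 'a::complex_banach"
  by unfold_locales (simp_all add: scaleC_add_right scaleC_add_left scaleC_scaleC scaleC_one)

definition bounded_operator :: "('a::complex_banach \<Rightarrow> 'a) \<Rightarrow> bool" where
  "bounded_operator f \<longleftrightarrow> bounded_linear f \<and> (\<forall>c x. f (c *\<^sub>C x) = c *\<^sub>C f x)"

text \<open>An \<open>n\<close>-tuple of operators is a family indexed by a finite type \<open>'n\<close>, with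
  \<open>n = CARD('n) \<ge> 1\<close>; the space \<open>X\<^sup>n\<close> is \<^typ>\<open>'a ^ 'n\<close>.\<close>

definition commuting_tuples :: "('n::finite \<Rightarrow> 'a::complex_banach \<Rightarrow> 'a) set" where
  "commuting_tuples =
     {T. (\<forall>i. bounded_operator (T i)) \<and> (\<forall>i j. T i \<circ> T j = T j \<circ> T i)}"

definition mutually_commuting ::
    "('n::finite \<Rightarrow> 'a::complex_banach \<Rightarrow> 'a) \<Rightarrow> ('n \<Rightarrow> 'a \<Rightarrow> 'a) \<Rightarrow> bool" where
  "mutually_commuting T S \<longleftrightarrow> (\<forall>i j. T i \<circ> S j = S j \<circ> T i)"

definition tuple_power ::
    "('n::finite \<Rightarrow> 'a::complex_banach \<Rightarrow> 'a) \<Rightarrow> nat \<Rightarrow> ('n \<Rightarrow> 'a \<Rightarrow> 'a)" where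
  "tuple_power T k = (\<lambda>i. T i ^^ k)"

definition null_space :: "('a::complex_banach \<Rightarrow> 'a) \<Rightarrow> 'a set" where
  "null_space f = {x. f x = 0}"

definition joint_null :: "('n::finite \<Rightarrow> 'a::complex_banach \<Rightarrow> 'a) \<Rightarrow> 'a set" where
  "joint_null T = (\<Inter>i. null_space (T i))"

definition joint_range :: "('n::finite \<Rightarrow> 'a::complex_banach \<Rightarrow> 'a) \<Rightarrow> 'a set" where
  "joint_range T = {\<Sum>i\<in>UNIV. y i | y. \<forall>i. y i \<in> range (T i)}"

definition generalized_null :: "('n::finite \<Rightarrow> 'a::complex_banach \<Rightarrow> 'a) \<Rightarrow> 'a set" where
  "generalized_null T = (\<Union>k. joint_null (tuple_power T k))"

definition generalized_range :: "('n::finite \<Rightarrow> 'a::complex_banach \<Rightarrow> 'a) \<Rightarrow> 'a set" where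
  "generalized_range T = (\<Inter>k. joint_range (tuple_power T k))"

definition ascent :: "('n::finite \<Rightarrow> 'a::complex_banach \<Rightarrow> 'a) \<Rightarrow> enat" where
  "ascent T =
     (if \<exists>k. joint_null (tuple_power T k) = joint_null (tuple_power T (k + 1))
      then enat (LEAST k. joint_null (tuple_power T k) = joint_null (tuple_power T (k + 1)))
      else \<infinity>)"

definition delta :: "('n::finite \<Rightarrow> 'a::complex_banach \<Rightarrow> 'a) \<Rightarrow> 'a \<Rightarrow> 'a ^ 'n" where
  "delta A x = (\<chi> i. A i x)"

definition finite_dimensional :: "'a::complex_banach set \<Rightarrow> bool" where
  "finite_dimensional V \<longleftrightarrow> (\<exists>B. finite B \<and> complex_vector.span B = V)"

definition upper_semi_Fredholm_tuples ::
    "('n::finite \<Rightarrow> 'a::complex_banach \<Rightarrow> 'a) set" where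
  "upper_semi_Fredholm_tuples =
     {T \<in> commuting_tuples. finite_dimensional (joint_null T) \<and> closed (range (delta T))}"

definition class_C :: "('n::finite \<Rightarrow> 'a::complex_banach \<Rightarrow> 'a) set" where
  "class_C = {T \<in> commuting_tuples.
     T \<in> upper_semi_Fredholm_tuples \<and>
     (\<exists>k0. \<forall>k\<ge>k0. \<forall>i j. i \<noteq> j \<longrightarrow>
        (T i ^^ k) ` null_space (T i ^^ (k + 1)) \<subseteq> null_space (T j)) \<and>
     (\<exists>m. \<forall>p\<ge>m. \<exists>A\<in>commuting_tuples.
        mutually_commuting A T \<and> joint_null A = {0} \<and>
        delta A ` (joint_null (tuple_power T p) \<inter> joint_range (tuple_power T p))
          \<subseteq> range (delta (tuple_power T p)))}"

end

theory Submission
  imports Defs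
begin

text \<open>
  One implication is a finite-dimensionality argument. The subspaces \<open>N(T) \<inter> R(T\<^sup>k)\<close> decrease
  with \<open>k\<close> inside the finite-dimensional space \<open>N(T)\<close>, hence are eventually equal to their
  intersection \<open>N(T) \<inter> R\<^sup>\<infinity>(T)\<close>. That intersection lies in \<open>N\<^sup>\<infinity>(T) \<inter> R\<^sup>\<infinity>(T)\<close>, so under the range
  condition \<open>N(T) \<inter> R(T\<^sup>k) = {0}\<close> for large \<open>k\<close>. The second condition defining the class makes
  \<open>T\<^sub>i\<^sup>k x\<close> an element of \<open>N(T) \<inter> R(T\<^sup>k)\<close> for every \<open>x \<in> N(T\<^sup>k\<^sup>+\<^sup>1)\<close>, so \<open>N(T\<^sup>k\<^sup>+\<^sup>1) = N(T\<^sup>k)\<close>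
  (lemmas \<open>decreasing_subspaces_stabilize\<close> and \<open>finite_ascent_if_trivial_intersection\<close>).

  For the converse, the crucial point is that the chain \<open>N(T\<^sup>k)\<close> is constant from the first
  repetition on (lemma \<open>joint_null_stable\<close>). This is less immediate than for a single operator,
  since \<open>x \<in> N(T\<^sup>k\<^sup>+\<^sup>2)\<close> does not give \<open>T\<^sub>i x \<in> N(T\<^sup>k\<^sup>+\<^sup>1)\<close>. It follows that \<open>N\<^sup>\<infinity>(T) = N(T\<^sup>p)\<close>
  for large \<open>p\<close>, which is closed. If \<open>y \<in> N(T\<^sup>p) \<inter> R(T\<^sup>p)\<close> and \<open>A\<close> is a tuple as in the third
  condition, then \<open>A\<^sub>i y = T\<^sub>i\<^sup>p x\<close> for a single \<open>x\<close> and all \<open>i\<close>; commutation yields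
  \<open>x \<in> N(T\<^sup>2\<^sup>p) = N(T\<^sup>p)\<close>, so every \<open>A\<^sub>i y\<close> vanishes, and so does \<open>y\<close>.
\<close>

lemma joint_null_power_iff:
  "x \<in> joint_null (tuple_power T k) \<longleftrightarrow> (\<forall>i. (T i ^^ k) x = 0)"
  by (simp add: joint_null_def null_space_def tuple_power_def)

lemma mem_joint_range_power_iff:
  "x \<in> joint_range (tuple_power T k) \<longleftrightarrow> (\<exists>u. x = (\<Sum>i\<in>UNIV. (T i ^^ k) (u i)))"
proof
  assume "x \<in> joint_range (tuple_power T k)"
  then obtain y where x: "x = (\<Sum>i\<in>UNIV. y i)" and y: "\<And>i. \<exists>u. y i = (T i ^^ k) u"
    unfolding joint_range_def tuple_power_def by blast
  from y obtain u where "\<And>i. y i = (T i ^^ k) (u i)"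
    by metis
  with x show "\<exists>u. x = (\<Sum>i\<in>UNIV. (T i ^^ k) (u i))"
    by auto
qed (auto simp: joint_range_def tuple_power_def)

lemma bounded_operator_funpow:
  assumes "bounded_operator f"
  shows "bounded_operator (f ^^ k)"
proof (induction k)
  case 0
  show ?case by (simp add: bounded_operator_def id_def bounded_linear_ident)
next
  case (Suc k)
  with assms show ?case
    by (auto simp: bounded_operator_def comp_def intro: bounded_linear_compose)
qed

lemma bounded_operator_zero: "bounded_operator f \<Longrightarrow> f 0 = 0"
  by (simp add: bounded_operator_def linear_simps)

lemma funpow_commute:
  assumes "f \<circ> g = g \<circ> f"
  shows "(f ^^ k) (g x) = g ((f ^^ k) x)"
  by (induction k) (use assms in \<open>auto simp: fun_eq_iff\<close>)

lemma commuting_power_operator: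
  assumes "T \<in> commuting_tuples"
  shows "bounded_operator (T i ^^ k)"
  using assms by (simp add: commuting_tuples_def bounded_operator_funpow)

lemma joint_null_power_closed:
  assumes "T \<in> commuting_tuples"
  shows "closed (joint_null (tuple_power T k))"
proof -
  have "closed {x. (T i ^^ k) x = 0}" for i
  proof -
    have "bounded_linear (T i ^^ k)"
      using commuting_power_operator[OF assms] by (simp add: bounded_operator_def)
    then show ?thesis
      by (intro closed_Collect_eq continuous_intros linear_continuous_on)
  qed
  then show ?thesis
    by (auto simp: joint_null_def null_space_def tuple_power_def)
qed

lemma joint_null_power_mono:
  assumes "T \<in> commuting_tuples" "k \<le> l"
  shows "joint_null (tuple_power T k) \<subseteq> joint_null (tuple_power T l)"
proof
  fix x assume "x \<in> joint_null (tuple_power T k)"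
  then have "(T i ^^ (l - k)) ((T i ^^ k) x) = 0" for i
    by (simp add: joint_null_power_iff bounded_operator_zero[OF commuting_power_operator[OF assms(1)]])
  moreover have "T i ^^ l = T i ^^ (l - k) \<circ> T i ^^ k" for i
    using assms(2) by (simp flip: funpow_add)
  ultimately show "x \<in> joint_null (tuple_power T l)"
    by (simp add: joint_null_power_iff)
qed

lemma joint_range_power_antimono:
  assumes "k \<le> l"
  shows "joint_range (tuple_power T l) \<subseteq> joint_range (tuple_power T k)"
proof
  fix x assume "x \<in> joint_range (tuple_power T l)"
  then obtain u where "x = (\<Sum>i\<in>UNIV. (T i ^^ l) (u i))"
    by (auto simp: mem_joint_range_power_iff)
  moreover have "T i ^^ l = T i ^^ k \<circ> T i ^^ (l - k)" for i
    using assms by (simp flip: funpow_add)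
  ultimately have "x = (\<Sum>i\<in>UNIV. (T i ^^ k) ((T i ^^ (l - k)) (u i)))"
    by simp
  then show "x \<in> joint_range (tuple_power T k)"
    unfolding mem_joint_range_power_iff by (rule exI[of _ "\<lambda>i. (T i ^^ (l - k)) (u i)"])
qed

lemma range_power_subset_joint_range:
  assumes "T \<in> commuting_tuples"
  shows "(T i ^^ k) x \<in> joint_range (tuple_power T k)"
proof -
  have "(\<Sum>j\<in>UNIV. (T j ^^ k) (if j = i then x else 0)) = (\<Sum>j\<in>UNIV. if j = i then (T i ^^ k) x else 0)"
    by (intro sum.cong refl)
      (auto simp: bounded_operator_zero[OF commuting_power_operator[OF assms]])
  also have "\<dots> = (T i ^^ k) x"
    by simp
  finally show ?thesis
    unfolding mem_joint_range_power_iff by (intro exI[of _ "\<lambda>j. if j = i then x else 0"]) simp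
qed

lemma joint_null_subspace:
  assumes "T \<in> commuting_tuples"
  shows "complex_vector.subspace (joint_null T)"
proof -
  have "bounded_operator (T i)" for i
    using assms by (simp add: commuting_tuples_def)
  then show ?thesis
    by (auto simp: complex_vector.subspace_def joint_null_def null_space_def
        bounded_operator_def linear_simps)
qed

lemma joint_range_power_subspace:
  assumes "T \<in> commuting_tuples"
  shows "complex_vector.subspace (joint_range (tuple_power T k))"
proof -
  have op: "bounded_linear (T i ^^ k)" "(T i ^^ k) (c *\<^sub>C x) = c *\<^sub>C (T i ^^ k) x" for i c x
    using commuting_power_operator[OF assms, where i = i and k = k] by (auto simp: bounded_operator_def)
  show ?thesis
    unfolding complex_vector.subspace_def
  proof (intro conjI ballI allI)
    have "(T i ^^ k) 0 = 0" for i
      using op(1) by (simp add: linear_simps)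
    then show "0 \<in> joint_range (tuple_power T k)"
      by (auto simp: mem_joint_range_power_iff intro!: exI[of _ "\<lambda>_. 0"])
  next
    fix x y assume "x \<in> joint_range (tuple_power T k)" "y \<in> joint_range (tuple_power T k)"
    then obtain u v where "x = (\<Sum>i\<in>UNIV. (T i ^^ k) (u i))" "y = (\<Sum>i\<in>UNIV. (T i ^^ k) (v i))"
      by (auto simp: mem_joint_range_power_iff)
    then have "x + y = (\<Sum>i\<in>UNIV. (T i ^^ k) (u i + v i))"
      by (simp add: sum.distrib linear_simps[OF op(1)])
    then show "x + y \<in> joint_range (tuple_power T k)"
      unfolding mem_joint_range_power_iff by (rule exI[of _ "\<lambda>i. u i + v i"])
  next
    fix c x assume "x \<in> joint_range (tuple_power T k)"
    then obtain u where "x = (\<Sum>i\<in>UNIV. (T i ^^ k) (u i))"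
      by (auto simp: mem_joint_range_power_iff)
    then have "c *\<^sub>C x = (\<Sum>i\<in>UNIV. (T i ^^ k) (c *\<^sub>C u i))"
      by (simp add: complex_vector.scale_sum_right op(2))
    then show "c *\<^sub>C x \<in> joint_range (tuple_power T k)"
      unfolding mem_joint_range_power_iff by (rule exI[of _ "\<lambda>i. c *\<^sub>C u i"])
  qed
qed

lemma zero_in_generalized_range:
  assumes "T \<in> commuting_tuples"
  shows "0 \<in> generalized_range T"
  using complex_vector.subspace_0[OF joint_range_power_subspace[OF assms]]
  by (simp add: generalized_range_def)

text \<open>
  A first repetition in the chain of joint null spaces makes \<open>N(T\<^sup>k)\<close> saturated: if every
  \<open>T\<^sub>j y\<close> lies in \<open>N(T\<^sup>k)\<close>, then \<open>y \<in> N(T\<^sup>k\<^sup>+\<^sup>1) = N(T\<^sup>k)\<close>. Applying \<open>T\<^sub>j\<close> lowers the order to which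
  \<open>T\<^sub>j\<close> kills a vector and keeps the other orders, so one inducts on the sum of the orders; this
  requires orders of vanishing that may differ from one operator to another.
\<close>
lemma joint_null_stable:
  assumes T: "T \<in> commuting_tuples"
    and eq: "joint_null (tuple_power T k) = joint_null (tuple_power T (k + 1))"
    and x: "\<And>i. (T i ^^ e i) x = 0"
  shows "x \<in> joint_null (tuple_power T k)"
  using x
proof (induction "\<Sum>i\<in>UNIV. e i" arbitrary: e x rule: less_induct)
  case less
  have zero: "(T i ^^ l) 0 = 0" for i l
    using bounded_operator_zero[OF commuting_power_operator[OF T]] .
  show ?case
  proof (cases "\<exists>i. e i = 0")
    case True
    then have "x = 0"
      using less.prems by (metis funpow_0)
    then show ?thesis
      by (simp add: joint_null_power_iff zero)
  next
    case False
    have "T j x \<in> joint_null (tuple_power T k)" for j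
    proof (rule less.hyps)
      show "(\<Sum>i\<in>UNIV. (e(j := e j - 1)) i) < (\<Sum>i\<in>UNIV. e i)"
        using False by (intro sum_strict_mono_ex1) (auto intro!: exI[of _ j])
    next
      fix i
      show "(T i ^^ (e(j := e j - 1)) i) (T j x) = 0"
      proof (cases "i = j")
        case True
        then have "(T i ^^ (e(j := e j - 1)) i) (T j x) = (T j ^^ Suc (e j - 1)) x"
          by (simp add: funpow_Suc_right del: funpow.simps)
        also have "Suc (e j - 1) = e j"
          using False by simp
        finally show ?thesis
          using less.prems by simp
      next
        case False
        have "(T i ^^ e i) (T j x) = T j ((T i ^^ e i) x)"
          using T by (intro funpow_commute) (simp add: commuting_tuples_def)
        then show ?thesis
          using False less.prems zero[where i = j and l = 1] by simp
      qed
    qed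
    then have "x \<in> joint_null (tuple_power T (k + 1))"
      by (simp add: joint_null_power_iff funpow_Suc_right del: funpow.simps)
    then show ?thesis
      using eq by simp
  qed
qed

lemma joint_null_power_eq_of_stable:
  assumes "T \<in> commuting_tuples"
    and "joint_null (tuple_power T k) = joint_null (tuple_power T (k + 1))"
    and "k \<le> l"
  shows "joint_null (tuple_power T l) = joint_null (tuple_power T k)"
  using joint_null_power_mono[OF assms(1,3)] joint_null_stable[OF assms(1,2), where e = "\<lambda>_. l"]
  by (auto simp: joint_null_power_iff)

text \<open>
  The descending chain condition for subspaces of a finite-dimensional space, inside an ambient
  space of arbitrary dimension. A member whose basis has the fewest elements cannot be strictly
  larger than a later one, since adjoining a vector to a basis of the latter would produce too
  many independent vectors.
\<close>
lemma (in vector_space) decreasing_subspaces_stabilize: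
  fixes S :: "nat \<Rightarrow> 'b set"
  assumes "finite B" and S: "\<And>k. subspace (S k)" "\<And>k. S k \<subseteq> span B"
    and anti: "\<And>k l. k \<le> l \<Longrightarrow> S l \<subseteq> S k"
  shows "\<exists>k. \<forall>l\<ge>k. S l = S k"
proof -
  have "\<exists>C. C \<subseteq> S k \<and> independent C \<and> S k \<subseteq> span C" for k
    by (metis maximal_independent_subset)
  then obtain C where C: "\<And>k. C k \<subseteq> S k" "\<And>k. independent (C k)" "\<And>k. S k \<subseteq> span (C k)"
    by metis
  have fin: "finite (C k)" for k
    using independent_span_bound[OF assms(1) C(2)] C(1) S(2) by blast
  obtain k where k: "\<And>l. card (C k) \<le> card (C l)"
    using ex_has_least_nat[of "\<lambda>_. True" 0 "\<lambda>k. card (C k)"] by blast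
  have "S l = S k" if kl: "k \<le> l" for l
  proof (rule ccontr)
    assume "S l \<noteq> S k"
    then obtain x where x: "x \<in> S k" "x \<notin> S l"
      using anti[OF kl] by blast
    have "span (C l) \<subseteq> S l"
      using C(1) S(1) by (simp add: span_minimal)
    then have notin: "x \<notin> span (C l)"
      using x by blast
    then have "independent (insert x (C l))"
      using C(2) by (simp add: independent_insertI)
    moreover have "insert x (C l) \<subseteq> span (C k)"
      using x C anti[OF kl] by blast
    ultimately have "card (insert x (C l)) \<le> card (C k)"
      using independent_span_bound[OF fin] by blast
    moreover have "x \<notin> C l"
      using notin span_base by blast
    ultimately show False
      using k[of l] fin[of l] by simp
  qed
  then show ?thesis by blast
qed

text \<open>
  From the stabilization index and \<open>k0\<close> on, \<open>T\<^sub>i\<^sup>k\<close> maps \<open>N(T\<^sup>k\<^sup>+\<^sup>1)\<close> into \<open>N(T) \<inter> R(T\<^sup>k)\<close>, which equals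
  \<open>N(T) \<inter> R\<^sup>\<infinity>(T)\<close> and is trivial.
\<close>
lemma finite_ascent_if_trivial_intersection:
  assumes T: "T \<in> commuting_tuples" and fin: "finite_dimensional (joint_null T)"
    and kernels: "\<And>k i j. k0 \<le> k \<Longrightarrow> i \<noteq> j \<Longrightarrow>
      (T i ^^ k) ` null_space (T i ^^ (k + 1)) \<subseteq> null_space (T j)"
    and trivial: "joint_null T \<inter> generalized_range T \<subseteq> {0}"
  shows "\<exists>k. joint_null (tuple_power T k) = joint_null (tuple_power T (k + 1))"
proof -
  define S where "S k = joint_null T \<inter> joint_range (tuple_power T k)" for k
  obtain B where B: "finite B" "complex_vector.span B = joint_null T"
    using fin by (auto simp: finite_dimensional_def)
  have "\<exists>k. \<forall>l\<ge>k. S l = S k"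
  proof (rule complex_vector.decreasing_subspaces_stabilize[OF B(1)])
    show "complex_vector.subspace (S k)" for k
      unfolding S_def
      by (intro complex_vector.subspace_inter joint_null_subspace joint_range_power_subspace T)
    show "S k \<subseteq> complex_vector.span B" for k
      by (auto simp: S_def B(2))
    show "S l \<subseteq> S k" if "k \<le> l" for k l
      using joint_range_power_antimono[OF that, of T] by (auto simp: S_def)
  qed
  then obtain k1 where k1: "\<And>l. k1 \<le> l \<Longrightarrow> S l = S k1"
    by blast
  have S_k1: "x = 0" if "x \<in> S k1" for x
  proof -
    have "x \<in> joint_range (tuple_power T l)" for l
    proof -
      have "x \<in> S (max k1 l)"
        using that k1[of "max k1 l"] by simp
      then show ?thesis
        using joint_range_power_antimono[of l "max k1 l" T] by (auto simp: S_def)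
    qed
    then show ?thesis
      using that trivial by (auto simp: S_def generalized_range_def)
  qed
  define k where "k = max k0 k1"
  have "(T i ^^ k) x = 0" if "x \<in> joint_null (tuple_power T (k + 1))" for i x
  proof -
    have x: "(T i ^^ (k + 1)) x = 0"
      using that unfolding joint_null_power_iff by blast
    have "T j ((T i ^^ k) x) = 0" for j
    proof (cases "i = j")
      case True
      then show ?thesis using x by simp
    next
      case False
      then show ?thesis
        using kernels[of k i j] x by (auto simp: k_def null_space_def)
    qed
    then have "(T i ^^ k) x \<in> S k"
      using range_power_subset_joint_range[OF T] by (auto simp: S_def joint_null_def null_space_def)
    then show ?thesis
      using S_k1 k1[of k] by (simp add: k_def)
  qed
  then have "joint_null (tuple_power T (k + 1)) \<subseteq> joint_null (tuple_power T k)"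
    unfolding joint_null_power_iff[of _ T k] subset_iff by blast
  moreover have "joint_null (tuple_power T k) \<subseteq> joint_null (tuple_power T (k + 1))"
    by (rule joint_null_power_mono[OF T]) simp
  ultimately show ?thesis
    by blast
qed

text \<open>
  If \<open>A\<close> carries \<open>y\<close> into the range of \<open>\<delta>\<close> for \<open>T\<^sup>p\<close>, say \<open>A\<^sub>i y = T\<^sub>i\<^sup>p x\<close>, then
  \<open>T\<^sub>i\<^sup>2\<^sup>p x = A\<^sub>i (T\<^sub>i\<^sup>p y) = 0\<close>. Joint injectivity of \<open>A\<close> then gives \<open>y = 0\<close>.
\<close>
lemma joint_null_inter_range_trivial:
  assumes A: "A \<in> commuting_tuples" "mutually_commuting A T" "joint_null A = {0}"
    and sub: "delta A ` (joint_null (tuple_power T p) \<inter> joint_range (tuple_power T p))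
      \<subseteq> range (delta (tuple_power T p))"
    and stable: "joint_null (tuple_power T (p + p)) \<subseteq> joint_null (tuple_power T p)"
    and y: "y \<in> joint_null (tuple_power T p)" "y \<in> joint_range (tuple_power T p)"
  shows "y = 0"
proof -
  obtain x where "delta A y = delta (tuple_power T p) x"
    using sub y by blast
  then have x: "A i y = (T i ^^ p) x" for i
    by (simp add: delta_def vec_eq_iff tuple_power_def)
  have "(T i ^^ (p + p)) x = 0" for i
  proof -
    have "(T i ^^ (p + p)) x = (T i ^^ p) (A i y)"
      by (simp add: funpow_add x)
    also have "\<dots> = A i ((T i ^^ p) y)"
      using A(2) by (intro funpow_commute) (simp add: mutually_commuting_def)
    also have "\<dots> = 0"
      using y(1) A(1) by (simp add: joint_null_power_iff commuting_tuples_def bounded_operator_zero)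
    finally show ?thesis .
  qed
  then have "x \<in> joint_null (tuple_power T (p + p))"
    by (simp add: joint_null_power_iff)
  then have "x \<in> joint_null (tuple_power T p)"
    using stable by blast
  then have "y \<in> joint_null A"
    unfolding joint_null_power_iff by (simp add: joint_null_def null_space_def x)
  then show ?thesis
    using A(3) by simp
qed

theorem corollary2p1:
  fixes T :: "'n::finite \<Rightarrow> 'a::complex_banach \<Rightarrow> 'a"
  assumes "T \<in> class_C"
  shows "ascent T < \<infinity> \<longleftrightarrow>
    closure (generalized_null T) \<inter> generalized_range T = {0}"
proof -
  have T: "T \<in> commuting_tuples" and fin: "finite_dimensional (joint_null T)"
    using assms by (auto simp: class_C_def upper_semi_Fredholm_tuples_def)
  from assms[unfolded class_C_def mem_Collect_eq]
  obtain k0 m where kernels: "\<forall>k\<ge>k0. \<forall>i j. i \<noteq> j \<longrightarrow>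
      (T i ^^ k) ` null_space (T i ^^ (k + 1)) \<subseteq> null_space (T j)"
    and m: "\<forall>p\<ge>m. \<exists>A\<in>commuting_tuples. mutually_commuting A T \<and> joint_null A = {0} \<and>
      delta A ` (joint_null (tuple_power T p) \<inter> joint_range (tuple_power T p))
        \<subseteq> range (delta (tuple_power T p))"
    by (elim conjE exE) (rule that)
  have "ascent T < \<infinity> \<longleftrightarrow>
      (\<exists>k. joint_null (tuple_power T k) = joint_null (tuple_power T (k + 1)))"
    by (simp add: ascent_def)
  also have "\<dots> \<longleftrightarrow> closure (generalized_null T) \<inter> generalized_range T = {0}"
  proof
    assume "\<exists>k. joint_null (tuple_power T k) = joint_null (tuple_power T (k + 1))"
    then obtain k where k: "joint_null (tuple_power T k) = joint_null (tuple_power T (k + 1))"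
      by blast
    define p where "p = max k m"
    have null_p: "joint_null (tuple_power T l) = joint_null (tuple_power T p)" if "p \<le> l" for l
    proof -
      have "k \<le> p" "k \<le> l"
        using that by (simp_all add: p_def)
      then show ?thesis
        using joint_null_power_eq_of_stable[OF T k] by blast
    qed
    have "joint_null (tuple_power T l) \<subseteq> joint_null (tuple_power T p)" for l
      using joint_null_power_mono[OF T, of l "max l p"] null_p[of "max l p"]
      by (metis max.cobounded1 max.cobounded2)
    then have "generalized_null T = joint_null (tuple_power T p)"
      by (auto simp: generalized_null_def)
    then have closure: "closure (generalized_null T) = joint_null (tuple_power T p)"
      by (simp add: joint_null_power_closed[OF T])
    obtain A where A: "A \<in> commuting_tuples" "mutually_commuting A T" "joint_null A = {0}"
        "delta A ` (joint_null (tuple_power T p) \<inter> joint_range (tuple_power T p))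
          \<subseteq> range (delta (tuple_power T p))"
      using m[rule_format, OF max.cobounded2[of m k], folded p_def] by (elim bexE conjE) (rule that)
    have "joint_null (tuple_power T (p + p)) \<subseteq> joint_null (tuple_power T p)"
      using null_p[OF le_add1[of p p]] by (rule equalityD1)
    then have "y = 0" if "y \<in> joint_null (tuple_power T p)" "y \<in> generalized_range T" for y
      using joint_null_inter_range_trivial[OF A] that by (auto simp: generalized_range_def)
    moreover have "0 \<in> joint_null (tuple_power T p)"
      by (simp add: joint_null_power_iff bounded_operator_zero[OF commuting_power_operator[OF T]])
    ultimately show "closure (generalized_null T) \<inter> generalized_range T = {0}"
      using zero_in_generalized_range[OF T] by (auto simp: closure)
  next
    assume trivial: "closure (generalized_null T) \<inter> generalized_range T = {0}"
    have "joint_null T = joint_null (tuple_power T 1)"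
      by (simp add: tuple_power_def)
    then have "joint_null T \<subseteq> closure (generalized_null T)"
      using closure_subset[of "generalized_null T"] unfolding generalized_null_def by blast
    then show "\<exists>k. joint_null (tuple_power T k) = joint_null (tuple_power T (k + 1))"
      using finite_ascent_if_trivial_intersection[OF T fin kernels[rule_format]] trivial by blast
  qed
  finally show ?thesis .
qed

end
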